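(* Let $\mathbf{C}$ be a class of bounded open subsets of $2^\omega$. Let also $(\mathcal{T}^{(e)}_n)_{e,n\in\mathbb{N}}$ be a countable family of tests (i.e., for all $e$, $(\mathcal{T}^{(e)}_n)_{n\in\mathbb{N}}$ is a test) such that $\mathcal{T}^{(e)}_n$ belongs to $\mathbf{C}$ for all $e,n$. Suppose we have the following closure properties. (P1) For all $\mathcal{U}\in\mathbf{C}$ and $\sigma\in 2^{<\omega}$, if $\mu(\mathcal{U}\mid\sigma)<1$, then there exists a $\mathcal{V}\in\mathbf{C}$ such that $(\mathcal{U}\mid\sigma)\subseteq\mathcal{V}$. (P2) For all $\mathcal{U}\in\mathbf{C}$, there exists a $\mathcal{V}\in\mathbf{C}$ such that $\mathcal{U}\subseteq\mathcal{V}$, and for all $\sigma\in 2^{<\omega}$, if $\mu(\mathcal{U}\mid\sigma)=1$, then $[\sigma]\subseteq\mathcal{V}$. (P3) For all $\mathcal{U}\in\mathbf{C}$ and $\sigma\in 2^{<\omega}$, if $\mu(\mathcal{U}\mid\sigma)<1$, then for all $e\in\mathbb{N}$, there exist $n_e\in\mathbb{N}$ and $\mathcal{V}\in\mathbf{C}$ such that $(\mathcal{U}\cup\mathcal{T}^{(e)}_{n_e})\subseteq\mathcal{V}$ and $\mu(\mathcal{V}\mid\sigma)<1$. Finally, let $W$ be a prefix-free subset of $2^{<\omega}$ such that $[W]$ cannot be covered by any open set $\mathcal{U}\in\mathbf{C}$ (i.e., $[W]\not\subseteq\mathcal{U}$ for every $\mathcal{U}\in\mathbf{C}$). Then, there exists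 $X\in W^\omega$ that passes all tests $\mathcal{T}^{(e)}=(\mathcal{T}^{(e)}_n)_{n\in\mathbb{N}}$, $e\in\mathbb{N}$.
   Context: $2^\omega$ is Cantor space (the set of infinite binary sequences), $2^{<\omega}$ is the set of finite binary strings, and $\mu$ is the Lebesgue (uniform) measure on $2^\omega$, with $\mu([\sigma])=2^{-|\sigma|}$. For a string $\sigma$, $[\sigma]$ is the set of infinite sequences with prefix $\sigma$; for $U\subseteq 2^{<\omega}$, $[U]=\bigcup_{\sigma\in U}[\sigma]$. A set of strings is prefix-free if no element of it is a proper prefix of another element. An open set is bounded if its measure is smaller than $1$. For $\mathcal{X}\subseteq 2^\omega$ and a string $\sigma$, $(\mathcal{X}\mid\sigma)=\{Z\in 2^\omega : \sigma Z\in\mathcal{X}\}$, and $\mu(\mathcal{X}\mid\sigma)$ is the measure of this set (equivalently $\mu(\mathcal{X}\cap[\sigma])/\mu([\sigma])$). A test is a non-increasing sequence $(\mathcal{U}_n)_{n\in\mathbb{N}}$ of open sets such that $\bigcap_n\mathcal{U}_n$ has measure $0$; a sequence $X\in 2^\omega$ fails the test if $X\in\bigcap_n\mathcal{U}_n$, and passes it otherwise. For $S\subseteq 2^{<\omega}$, $S^\omega$ is the set of $A\in 2^\omega$ such that $A=\sigma_0\sigma_1\sigma_2\ldots$ with $\sigma_i\in S$ for all $i$.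
   Formalization: The formal statement also assumes that W does not contain the empty string; this excludes only W = {empty string}, where W^ω is empty and the claim fails (e.g. C = {∅} with all tests empty). *)

theory Defs
  imports "HOL-Probability.Probability" "HOL-Library.Sublist"
begin

text \<open>Cantor space is the type \<^typ>\<open>bool stream\<close>, finite binary strings are \<^typ>\<open>bool list\<close>, and
  the concatenation of a string and an infinite sequence is \<open>\<sigma> @- Z\<close>.\<close>

text \<open>The product topology of \<^typ>\<open>nat \<Rightarrow> bool\<close> (with \<^typ>\<open>bool\<close> discrete), transported along the
  bijection between streams and functions. Lemma \<open>openin_cantor_iff\<close> below identifies its open sets
  with the unions of cylinders.\<close>

definition cantor_topology :: "bool stream topology" where
  "cantor_topology = pullback_topology UNIV (!!) euclidean"

definition cantor_measure :: "bool stream measure" where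
  "cantor_measure = stream_space (measure_pmf (pmf_of_set UNIV))"

definition cylinder :: "bool list \<Rightarrow> bool stream set" where
  "cylinder \<sigma> = range (\<lambda>Z. \<sigma> @- Z)"

definition cylinders :: "bool list set \<Rightarrow> bool stream set" where
  "cylinders U = (\<Union>\<sigma>\<in>U. cylinder \<sigma>)"

definition prefix_free :: "bool list set \<Rightarrow> bool" where
  "prefix_free W \<longleftrightarrow> (\<forall>\<sigma>\<in>W. \<forall>\<tau>\<in>W. \<not> strict_prefix \<sigma> \<tau>)"

definition bounded_open :: "bool stream set \<Rightarrow> bool" where
  "bounded_open U \<longleftrightarrow> openin cantor_topology U \<and> measure cantor_measure U < 1"

text \<open>\<open>relativize U \<sigma>\<close> is the set \<open>(U | \<sigma>)\<close>.\<close>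

definition relativize :: "bool stream set \<Rightarrow> bool list \<Rightarrow> bool stream set" where
  "relativize U \<sigma> = {Z. \<sigma> @- Z \<in> U}"

definition is_test :: "(nat \<Rightarrow> bool stream set) \<Rightarrow> bool" where
  "is_test T \<longleftrightarrow> decseq T \<and> (\<forall>n. openin cantor_topology (T n))
     \<and> measure cantor_measure (\<Inter>n. T n) = 0"

definition passes :: "bool stream \<Rightarrow> (nat \<Rightarrow> bool stream set) \<Rightarrow> bool" where
  "passes X T \<longleftrightarrow> X \<notin> (\<Inter>n. T n)"

text \<open>The infinite concatenations \<open>\<sigma>\<^sub>0 \<sigma>\<^sub>1 \<sigma>\<^sub>2 \<dots>\<close> of strings in \<open>S\<close>. Empty factors contribute nothing,
  and a concatenation with only finitely many nonempty factors is not an infinite sequence; hence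
  the empty string can be dropped from \<open>S\<close>. This matters because \<^const>\<open>flat\<close> is only specified
  on streams of nonempty lists. In particular \<open>omega_power {[]} = {}\<close>.\<close>

definition omega_power :: "bool list set \<Rightarrow> bool stream set" where
  "omega_power S = flat ` streams (S - {[]})"

lemma mem_cylinder_iff: "X \<in> cylinder \<sigma> \<longleftrightarrow> stake (length \<sigma>) X = \<sigma>"
proof
  assume "X \<in> cylinder \<sigma>"
  then obtain Z where "X = \<sigma> @- Z"
    by (auto simp: cylinder_def)
  then show "stake (length \<sigma>) X = \<sigma>"
    by (simp add: stake_shift)
next
  assume "stake (length \<sigma>) X = \<sigma>"
  then have "X = \<sigma> @- sdrop (length \<sigma>) X"
    by (metis stake_sdrop)
  then show "X \<in> cylinder \<sigma>"
    by (auto simp: cylinder_def)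
qed

lemma mem_cylinder_snth: "X \<in> cylinder \<sigma> \<longleftrightarrow> (\<forall>i<length \<sigma>. X !! i = \<sigma> ! i)"
  unfolding mem_cylinder_iff by (auto simp: list_eq_iff_nth_eq)

lemma openin_cantor_cylinder: "openin cantor_topology (cylinder \<sigma>)"
proof -
  let ?B = "\<Pi>\<^sub>E i\<in>UNIV. if i < length \<sigma> then {\<sigma> ! i} else (UNIV :: bool set)"
  have "open ?B"
  proof (rule open_PiE)
    show "open (if i < length \<sigma> then {\<sigma> ! i} else UNIV)" for i
      by (simp add: Topological_Spaces.open_discrete)
    show "finite {i. (if i < length \<sigma> then {\<sigma> ! i} else UNIV) \<noteq> (UNIV :: bool set)}"
      by (rule finite_subset[of _ "{..<length \<sigma>}"]) auto
  qed
  moreover have "cylinder \<sigma> = (!!) -` ?B \<inter> UNIV"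
    by (intro set_eqI) (simp add: mem_cylinder_snth PiE_iff)
  ultimately show ?thesis
    unfolding cantor_topology_def openin_pullback_topology by auto
qed

lemma openin_cantor_iff: "openin cantor_topology U \<longleftrightarrow> (\<exists>G. U = cylinders G)"
proof
  assume "\<exists>G. U = cylinders G"
  then show "openin cantor_topology U"
    by (auto simp: cylinders_def openin_cantor_cylinder)
next
  assume "openin cantor_topology U"
  then obtain V :: "(nat \<Rightarrow> bool) set" where V: "open V" "U = (!!) -` V"
    unfolding cantor_topology_def openin_pullback_topology by auto
  have "\<exists>n. cylinder (stake n X) \<subseteq> U" if "X \<in> U" for X
  proof -
    have "(!!) X \<in> V"
      using that V by auto
    then obtain B where B: "(!!) X \<in> (\<Pi>\<^sub>E i\<in>UNIV. B i)" "finite {i. B i \<noteq> UNIV}"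
      "(\<Pi>\<^sub>E i\<in>UNIV. B i) \<subseteq> V"
      using product_topology_open_contains_basis[of "\<lambda>_. euclidean" UNIV V "(!!) X"] V(1)
      unfolding open_fun_def by auto
    obtain n where n: "{i. B i \<noteq> UNIV} \<subseteq> {..<n}"
      using B(2) by (metis finite_nat_iff_bounded)
    have "cylinder (stake n X) \<subseteq> U"
    proof
      fix Y assume "Y \<in> cylinder (stake n X)"
      then have eq: "Y !! i = X !! i" if "i < n" for i
        using that by (simp add: mem_cylinder_snth)
      have "Y !! i \<in> B i" for i
      proof (cases "i < n")
        case True
        then show ?thesis using B(1) eq by auto
      next
        case False
        then have "B i = UNIV" using n by blast
        then show ?thesis by simp
      qed
      then show "Y \<in> U"
        using B(3) V(2) by (auto simp: PiE_iff)
    qed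
    then show ?thesis ..
  qed
  moreover have "X \<in> cylinder (stake n X)" for X n
    by (simp add: mem_cylinder_iff)
  ultimately have "U = cylinders {\<sigma>. cylinder \<sigma> \<subseteq> U}"
    unfolding cylinders_def by blast
  then show "\<exists>G. U = cylinders G" ..
qed

lemma sets_cantor_cylinder: "cylinder \<sigma> \<in> sets cantor_measure"
proof -
  have "cylinder \<sigma> = {X \<in> space cantor_measure. \<forall>i<length \<sigma>. X !! i = \<sigma> ! i}"
    by (auto simp: mem_cylinder_snth cantor_measure_def space_stream_space)
  also have "\<dots> \<in> sets cantor_measure"
    unfolding cantor_measure_def by measurable
  finally show ?thesis .
qed

lemma sets_cantor_openin: "openin cantor_topology U \<Longrightarrow> U \<in> sets cantor_measure"
  by (auto simp: openin_cantor_iff cylinders_def intro!: sets.countable_UN' sets_cantor_cylinder)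

lemma emeasure_cantor_cylinder: "emeasure cantor_measure (cylinder \<sigma>) = (1/2) ^ length \<sigma>"
proof (induction \<sigma>)
  case Nil
  have "cylinder [] = space cantor_measure"
    by (auto simp: cylinder_def cantor_measure_def space_stream_space)
  then show ?case
    using prob_space.emeasure_space_1[OF prob_space.prob_space_stream_space[OF prob_space_measure_pmf]] by (simp add: cantor_measure_def)
next
  case (Cons b \<sigma>)
  let ?M = "measure_pmf (pmf_of_set (UNIV :: bool set))"
  have *: "{X \<in> space (stream_space ?M). c ## X \<in> cylinder (b # \<sigma>)} = (if c = b then cylinder \<sigma> else {})" for c
    by (auto simp: mem_cylinder_iff space_stream_space)
  have "emeasure cantor_measure (cylinder (b # \<sigma>))
      = (\<integral>\<^sup>+c. emeasure (stream_space ?M) (if c = b then cylinder \<sigma> else {}) \<partial>?M)"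
    using sets_cantor_cylinder[of "b # \<sigma>"] unfolding cantor_measure_def
    by (subst prob_space.emeasure_stream_space[OF prob_space_measure_pmf]) (simp_all add: *)
  also have "\<dots> = (\<integral>\<^sup>+c. (1/2) ^ length \<sigma> * indicator {b} c \<partial>?M)"
    using Cons by (intro nn_integral_cong) (auto simp: cantor_measure_def indicator_def)
  also have "\<dots> = (1/2) ^ length \<sigma> * emeasure ?M {b}"
    by (simp add: nn_integral_cmult_indicator)
  also have "emeasure ?M {b} = 1/2"
    by (simp add: emeasure_pmf_single divide_ennreal_def flip: ennreal_divide_numeral)
  finally show ?case
    by (simp add: mult.commute)
qed

end

theory Submission
  imports Defs
begin

text \<open>
  The witness is \<open>X = \<sigma>\<^sub>0 \<sigma>\<^sub>1 \<sigma>\<^sub>2 \<dots>\<close> with words \<open>\<sigma>\<^sub>k \<in> W\<close> found by a forcing construction. A condition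
  is a pair \<open>(\<tau>, U)\<close> of a string and a set \<open>U \<in> C\<close> with \<open>\<mu>(U | \<tau>) < 1\<close>: the prefix \<open>\<tau>\<close> of \<open>X\<close> is
  decided, and \<open>X\<close> is promised to stay out of \<open>U\<close>. The condition on the measure keeps the promise
  fulfillable: an open set that contains \<open>X\<close> contains the whole cylinder of a long enough
  prefix of \<open>X\<close>, so its relative measure there is \<open>1\<close>. Hence \<open>X\<close> avoids every promised set
  as soon as the conditions \<open>(\<tau>\<^sub>k, U\<^sub>k)\<close> have increasing \<open>U\<^sub>k\<close> and strings \<open>\<tau>\<^sub>k\<close> exhausting \<open>X\<close>
  (\<open>flat_avoids_increasing_open_sets\<close>).

  Two moves extend a condition. (P3) enlarges \<open>U\<close> by a component of the next test, which guarantees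
  that \<open>X\<close> passes this test. Then (P1), (P2) and the fact that \<open>C\<close> cannot cover \<open>[W]\<close> give a word
  of \<open>W\<close> by which \<open>\<tau>\<close> can be prolonged without losing the measure condition (\<open>extend_by_word\<close>).
\<close>

lemma prob_space_cantor_measure: "prob_space cantor_measure"
  unfolding cantor_measure_def
  by (rule prob_space.prob_space_stream_space[OF prob_space_measure_pmf])

lemma space_cantor_measure: "space cantor_measure = UNIV"
  by (simp add: cantor_measure_def space_stream_space)

lemma relativize_append: "relativize U (\<sigma> @ \<tau>) = relativize (relativize U \<sigma>) \<tau>"
  by (simp add: relativize_def)

lemma relativize_mono: "U \<subseteq> V \<Longrightarrow> relativize U \<sigma> \<subseteq> relativize V \<sigma>"
  by (auto simp: relativize_def)

lemma relativize_Nil: "relativize U [] = U"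
  by (simp add: relativize_def)

lemma relativize_eq_UNIV_iff: "relativize U \<sigma> = UNIV \<longleftrightarrow> cylinder \<sigma> \<subseteq> U"
  by (auto simp: relativize_def cylinder_def)

lemma sets_relativize:
  assumes "U \<in> sets cantor_measure"
  shows "relativize U \<sigma> \<in> sets cantor_measure"
proof -
  have "(\<lambda>Z. \<sigma> @- Z) \<in> cantor_measure \<rightarrow>\<^sub>M cantor_measure"
    unfolding cantor_measure_def by (induction \<sigma>) simp_all
  from measurable_sets[OF this assms] show ?thesis
    by (simp add: relativize_def vimage_def space_cantor_measure)
qed

lemma flat_conv_shift:
  assumes "[] \<notin> sset ws"
  shows "flat ws = concat (stake k ws) @- flat (sdrop k ws)"
  using assms
proof (induction k arbitrary: ws)
  case (Suc k)
  obtain w ws' where ws: "ws = w ## ws'"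
    by (cases ws)
  with Suc.prems have "w \<noteq> []" and "[] \<notin> sset ws'"
    by auto
  with Suc.IH[of ws'] ws show ?case
    by simp
qed simp

lemma length_concat_stake:
  assumes "[] \<notin> sset ws"
  shows "k \<le> length (concat (stake k ws))"
  using assms
proof (induction k arbitrary: ws)
  case (Suc k)
  obtain w ws' where ws: "ws = w ## ws'"
    by (cases ws)
  with Suc.prems have "length w \<ge> 1" and "[] \<notin> sset ws'"
    by (auto simp: Suc_le_eq)
  with Suc.IH[of ws'] ws show ?case
    by simp
qed simp

text \<open>A point of an open set enters it at a finite stage: from some length on, each prefix
  already forces membership.\<close>

lemma openin_cantor_contains_cylinder:
  assumes "openin cantor_topology U" and "X \<in> U"
  obtains n where "\<And>\<tau>. n \<le> length \<tau> \<Longrightarrow> X \<in> cylinder \<tau> \<Longrightarrow> cylinder \<tau> \<subseteq> U"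
proof -
  from assms obtain \<sigma> where \<sigma>: "X \<in> cylinder \<sigma>" "cylinder \<sigma> \<subseteq> U"
    by (auto simp: openin_cantor_iff cylinders_def)
  have "cylinder \<tau> \<subseteq> cylinder \<sigma>" if "length \<sigma> \<le> length \<tau>" "X \<in> cylinder \<tau>" for \<tau>
    using that \<sigma>(1) by (auto simp: mem_cylinder_snth)
  with \<sigma>(2) show thesis
    by (intro that[of "length \<sigma>"]) blast
qed

text \<open>If the limit entered some \<open>U j\<close>, then it would do so together with the cylinder of a prefix
  \<open>\<tau>\<^sub>k\<close> with \<open>k \<ge> j\<close>; this cylinder would lie in \<open>U k\<close>, whose relative measure at \<open>\<tau>\<^sub>k\<close> would be \<open>1\<close>.\<close>

lemma flat_avoids_increasing_open_sets:
  assumes nonempty: "[] \<notin> sset ws"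
    and "incseq U" and opn: "\<And>k. openin cantor_topology (U k)"
    and less1: "\<And>k. measure cantor_measure (relativize (U k) (concat (stake k ws))) < 1"
  shows "flat ws \<notin> U j"
proof
  assume "flat ws \<in> U j"
  with opn obtain n where
    n: "\<And>\<tau>. n \<le> length \<tau> \<Longrightarrow> flat ws \<in> cylinder \<tau> \<Longrightarrow> cylinder \<tau> \<subseteq> U j"
    using openin_cantor_contains_cylinder by blast
  define k where "k = max j n"
  have "flat ws \<in> cylinder (concat (stake k ws))"
    unfolding cylinder_def using flat_conv_shift[OF nonempty] by blast
  moreover have "n \<le> length (concat (stake k ws))"
    using length_concat_stake[OF nonempty, of k] by (simp add: k_def)
  ultimately have "cylinder (concat (stake k ws)) \<subseteq> U j"
    by (rule n[rotated])
  also have "\<dots> \<subseteq> U k"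
    using \<open>incseq U\<close> by (simp add: incseqD k_def)
  finally have "relativize (U k) (concat (stake k ws)) = space cantor_measure"
    by (simp add: relativize_eq_UNIV_iff space_cantor_measure)
  with less1[of k] show False
    using prob_space.prob_space[OF prob_space_cantor_measure] by simp
qed

text \<open>By (P1) pass to a set \<open>V\<close> of the class above \<open>(U | \<tau>)\<close>, and by (P2) to one that also
  covers every cylinder in which \<open>V\<close> has full measure. The latter cannot cover \<open>[W]\<close>, so \<open>V\<close>, and
  with it \<open>(U | \<tau>)\<close>, has less than full measure in the cylinder of some word of \<open>W\<close>.\<close>

lemma extend_by_word:
  assumes C: "\<And>U. U \<in> C \<Longrightarrow> bounded_open U"
    and P1: "\<And>U \<sigma>. U \<in> C \<Longrightarrow> measure cantor_measure (relativize U \<sigma>) < 1 \<Longrightarrow>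
               \<exists>V\<in>C. relativize U \<sigma> \<subseteq> V"
    and P2: "\<And>U. U \<in> C \<Longrightarrow>
               \<exists>V\<in>C. U \<subseteq> V \<and>
                 (\<forall>\<sigma>. measure cantor_measure (relativize U \<sigma>) = 1 \<longrightarrow> cylinder \<sigma> \<subseteq> V)"
    and W_not_covered: "\<And>U. U \<in> C \<Longrightarrow> \<not> cylinders W \<subseteq> U"
    and U: "U \<in> C" "measure cantor_measure (relativize U \<tau>) < 1"
  obtains \<sigma> where "\<sigma> \<in> W" "measure cantor_measure (relativize U (\<tau> @ \<sigma>)) < 1"
proof -
  interpret prob_space cantor_measure
    by (rule prob_space_cantor_measure)
  obtain V where V: "V \<in> C" "relativize U \<tau> \<subseteq> V"
    using P1[OF U] by blast
  obtain V' where V': "V' \<in> C"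
    "\<And>\<sigma>. measure cantor_measure (relativize V \<sigma>) = 1 \<Longrightarrow> cylinder \<sigma> \<subseteq> V'"
    using P2[OF V(1)] by blast
  obtain \<sigma> where \<sigma>: "\<sigma> \<in> W" "\<not> cylinder \<sigma> \<subseteq> V'"
    using W_not_covered[OF V'(1)] by (auto simp: cylinders_def)
  have "relativize V \<sigma> \<in> sets cantor_measure"
    using C[OF V(1)] by (simp add: bounded_open_def sets_cantor_openin sets_relativize)
  then have "prob (relativize U (\<tau> @ \<sigma>)) \<le> prob (relativize V \<sigma>)"
    unfolding relativize_append by (intro finite_measure_mono relativize_mono V(2))
  also have "\<dots> < 1"
    using V'(2)[of \<sigma>] \<sigma>(2) prob_le_1[of "relativize V \<sigma>"] by linarith
  finally show thesis
    using \<sigma>(1) that by blast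
qed

theorem lemma3p1:
  fixes C :: "bool stream set set"
    and T :: "nat \<Rightarrow> nat \<Rightarrow> bool stream set"
    and W :: "bool list set"
  assumes C: "\<And>U. U \<in> C \<Longrightarrow> bounded_open U"
    and tests: "\<And>e. is_test (T e)"
    and T_in_C: "\<And>e n. T e n \<in> C"
    and P1: "\<And>U \<sigma>. U \<in> C \<Longrightarrow> measure cantor_measure (relativize U \<sigma>) < 1 \<Longrightarrow>
               \<exists>V\<in>C. relativize U \<sigma> \<subseteq> V"
    and P2: "\<And>U. U \<in> C \<Longrightarrow>
               \<exists>V\<in>C. U \<subseteq> V \<and>
                 (\<forall>\<sigma>. measure cantor_measure (relativize U \<sigma>) = 1 \<longrightarrow> cylinder \<sigma> \<subseteq> V)"
    and P3: "\<And>U \<sigma> e. U \<in> C \<Longrightarrow> measure cantor_measure (relativize U \<sigma>) < 1 \<Longrightarrow>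
               \<exists>n. \<exists>V\<in>C. U \<union> T e n \<subseteq> V \<and> measure cantor_measure (relativize V \<sigma>) < 1"
    and W_prefix_free: "prefix_free W"
    and W_nonempty_strings: "[] \<notin> W"
    and W_not_covered: "\<And>U. U \<in> C \<Longrightarrow> \<not> cylinders W \<subseteq> U"
  shows "\<exists>X\<in>omega_power W. \<forall>e. passes X (T e)"
proof -
  let ?\<mu> = "measure cantor_measure"
  define cond where "cond = (\<lambda>(\<tau>, U). U \<in> C \<and> ?\<mu> (relativize U \<tau>) < 1)"
  define extends where "extends = (\<lambda>e (\<tau>, U) (\<tau>', U').
    U \<subseteq> U' \<and> (\<exists>n. T e n \<subseteq> U') \<and> (\<exists>\<sigma>\<in>W. \<tau>' = \<tau> @ \<sigma>))"
  have "\<exists>p. \<forall>k. (cond (p k) \<and> (k = 0 \<longrightarrow> fst (p k) = [])) \<and> extends k (p k) (p (Suc k))"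
  proof (rule dependent_nat_choice)
    \<comment> \<open>Any set of the class can start the construction, as its measure is below \<open>1\<close>.\<close>
    have "cond ([], T 0 0)"
      using T_in_C[of 0 0] C[OF T_in_C[of 0 0]]
      by (simp add: cond_def bounded_open_def relativize_Nil)
    then show "\<exists>x. cond x \<and> (0 = (0::nat) \<longrightarrow> fst x = [])"
      by (intro exI[of _ "([], T 0 0)"]) simp
  next
    fix x and e :: nat
    assume "cond x \<and> (e = 0 \<longrightarrow> fst x = [])"
    then obtain \<tau> U where x: "x = (\<tau>, U)" and U: "U \<in> C" "?\<mu> (relativize U \<tau>) < 1"
      by (cases x) (auto simp: cond_def)
    obtain n V where V: "U \<union> T e n \<subseteq> V" "V \<in> C" "?\<mu> (relativize V \<tau>) < 1"
      using P3[OF U, of e] by blast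
    obtain \<sigma> where \<sigma>: "\<sigma> \<in> W" "?\<mu> (relativize V (\<tau> @ \<sigma>)) < 1"
      using extend_by_word[OF C P1 P2 W_not_covered V(2,3)] by blast
    have "cond (\<tau> @ \<sigma>, V)" "extends e x (\<tau> @ \<sigma>, V)"
      using V \<sigma> by (auto simp: cond_def extends_def x)
    then show "\<exists>y. (cond y \<and> (Suc e = 0 \<longrightarrow> fst y = [])) \<and> extends e x y"
      by blast
  qed
  then obtain p where p: "\<And>k. cond (p k)" "fst (p 0) = []" "\<And>k. extends k (p k) (p (Suc k))"
    by blast
  define U where "U k = snd (p k)" for k
  have U_C: "U k \<in> C" and U_less: "?\<mu> (relativize (U k) (fst (p k))) < 1" for k
    using p(1)[of k] by (auto simp: cond_def U_def split: prod.splits)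
  have U_Suc: "U k \<subseteq> U (Suc k)" and U_T: "\<exists>n. T k n \<subseteq> U (Suc k)"
    and word: "\<exists>\<sigma>\<in>W. fst (p (Suc k)) = fst (p k) @ \<sigma>" for k
    using p(3)[of k] by (auto simp: extends_def U_def split: prod.splits)
  obtain s where s: "\<And>k. s k \<in> W" "\<And>k. fst (p (Suc k)) = fst (p k) @ s k"
    using word by metis
  define ws where "ws = smap s nats"
  have "fst (p k) = concat (stake k ws)" for k
  proof (induction k)
    case (Suc k)
    then show ?case
      by (simp add: s(2) stake_Suc ws_def)
  qed (simp add: p(2))
  moreover have ws_W: "sset ws \<subseteq> W - {[]}"
    using s(1) W_nonempty_strings by (auto simp: ws_def stream.set_map)
  ultimately have avoids: "flat ws \<notin> U k" for k
    using U_less U_Suc C[OF U_C]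
    by (intro flat_avoids_increasing_open_sets) (auto simp: bounded_open_def incseq_SucI)
  show ?thesis
  proof (intro bexI allI)
    show "passes (flat ws) (T e)" for e
      using U_T[of e] avoids[of "Suc e"] by (auto simp: passes_def)
    show "flat ws \<in> omega_power W"
      using ws_W by (auto simp: omega_power_def streams_iff_sset)
  qed
qed

end
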